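(* Let $\Theta\subseteq\mathbb{R}^d$, let $\{p(\cdot|\theta),\ \theta\in\Theta\}$ be a family of probability density functions of $\boldsymbol{X}=(X_1,\ldots,X_n)$, and let $\rho:\mathbb{R}^d\to[0,\infty)$, $\rho(0)=0$, be a convex loss function such that $\rho(\varepsilon)$ depends on the $d$-dimensional error vector $\varepsilon$ only via its norm $\|\varepsilon\|$. Let $\theta_0,\theta_1,\ldots,\theta_{m-1}\in\Theta$ and $q_0,q_1,\ldots,q_{m-1}$ (non-negative reals summing to one) be given. Let $T_0,T_1,\ldots,T_{m-1}$ be $m$ unitary $d\times d$ transformation matrices with the properties: (i) $\theta\in\Theta$ if and only if $T_i\theta\in\Theta$ for all $i=0,1,\ldots,m-1$, and (ii) $T_0+T_1+\cdots+T_{m-1}=0$; or, more generally, let $T_0,\ldots,T_{m-1}$ be transformations, possibly non-linear, that all map $\Theta$ onto itself, all preserve norms, and satisfy $\sum_{i=0}^{m-1}T_i(\theta)=0$ for all $\theta\in\Theta$. Then $$R_n(\Theta)\ \ge\ m\cdot\rho\left(\frac1m\sum_{i=0}^{m-1}T_i\theta_i\right)\cdot\int_{\mathbb{R}^n}\min\{q_0\cdot p(\boldsymbol{x}|\theta_0),\ldots,q_{m-1}\cdot p(\boldsymbol{x}|\theta_{m-1})\}\,d\boldsymbol{x}.$$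
   Context: Each $X_i$ takes values in an alphabet $\mathcal{X}$ (a finite or countable set, an interval, or the real line); in the discrete case densities are probability mass functions and integrals over the observation space are sums. $\mathbf{E}_\theta$ denotes expectation with respect to $p(\cdot|\theta)$. An estimator is a function $g_n:\mathcal{X}^n\to\Theta$. The minimax risk is $$R_n(\Theta)=\inf_{g_n}\sup_{\theta\in\Theta}\mathbf{E}_\theta\{\rho(g_n[\boldsymbol{X}]-\theta)\},$$ the infimum being over all estimators. For a non-linear transformation, $T_i\theta$ means $T_i(\theta)$.
   Formalization: For the possibly non-linear transformations, "all preserve norms" is taken to mean that norms of differences are preserved, ‖T_i(θ)−T_i(θ')‖=‖θ−θ'‖ on Θ; with only ‖T_i(θ)‖=‖θ‖ the bound is false. *)

theory Defs
  imports "HOL-Analysis.Analysis"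
begin

text \<open>
  The alphabet is the space of a sigma-finite reference measure \<open>\<nu>\<close>, against which densities are
  taken and integrals over the observation space are formed. A finite or countable alphabet
  \<open>A\<close> is \<open>\<nu> = count_space A\<close> (densities are mass functions, integrals are sums); an interval
  \<open>I\<close> is \<open>\<nu> = restrict_space lborel I\<close>; the real line is \<open>\<nu> = lborel\<close>.
\<close>

lemma sigma_finite_discrete_alphabet:
  "countable A \<Longrightarrow> sigma_finite_measure (count_space A)"
  by (rule sigma_finite_measure_count_space_countable)

lemma sigma_finite_interval_alphabet:
  fixes I :: "real set"
  assumes "is_interval I"
  shows "sigma_finite_measure (restrict_space lborel I)"
proof (rule sigma_finite_measure_restrict_space)
  show "sigma_finite_measure (lborel :: real measure)"
    by (rule sigma_finite_lborel)
  have "I \<in> sets borel"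
    using assms by (rule real_interval_borel_measurable)
  then show "I \<in> sets lborel"
    by simp
qed

definition obs_space :: "'a measure \<Rightarrow> nat \<Rightarrow> (nat \<Rightarrow> 'a) measure" where
  "obs_space \<nu> n = (\<Pi>\<^sub>M i\<in>{1..n}. \<nu>)"

definition density_family ::
  "'x measure \<Rightarrow> 'p set \<Rightarrow> ('p \<Rightarrow> 'x \<Rightarrow> real) \<Rightarrow> bool" where
  "density_family M \<Theta> p \<longleftrightarrow>
     (\<forall>\<theta>\<in>\<Theta>. p \<theta> \<in> borel_measurable M \<and>
            (\<forall>x\<in>space M. 0 \<le> p \<theta> x) \<and>
            (\<integral>\<^sup>+x. ennreal (p \<theta> x) \<partial>M) = 1)"

text \<open>
  Estimators are measurable, so that their risks are defined. They take values in \<open>\<Theta>\<close>, and on a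
  countable alphabet every \<open>\<Theta>\<close>-valued function on the observation space is measurable.
\<close>

definition estimators ::
  "'x measure \<Rightarrow> ('p::topological_space) set \<Rightarrow> ('x \<Rightarrow> 'p) set" where
  "estimators M \<Theta> = measurable M (restrict_space borel \<Theta>)"

text \<open>Risks may be infinite, hence the values in \<open>ennreal\<close>.\<close>

definition risk ::
  "'x measure \<Rightarrow> ('p::real_normed_vector \<Rightarrow> 'x \<Rightarrow> real) \<Rightarrow> ('p \<Rightarrow> real) \<Rightarrow> ('x \<Rightarrow> 'p) \<Rightarrow> 'p \<Rightarrow> ennreal"
where
  "risk M p \<rho> g \<theta> = (\<integral>\<^sup>+x. ennreal (\<rho> (g x - \<theta>)) \<partial>(density M (\<lambda>x. ennreal (p \<theta> x))))"

definition minimax_risk ::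
  "'x measure \<Rightarrow> ('p::real_normed_vector \<Rightarrow> 'x \<Rightarrow> real) \<Rightarrow> ('p \<Rightarrow> real) \<Rightarrow> 'p set \<Rightarrow> ennreal" where
  "minimax_risk M p \<rho> \<Theta> = (INF g\<in>estimators M \<Theta>. SUP \<theta>\<in>\<Theta>. risk M p \<rho> g \<theta>)"

definition radial_convex_loss :: "('p::real_normed_vector \<Rightarrow> real) \<Rightarrow> bool" where
  "radial_convex_loss \<rho> \<longleftrightarrow>
     (\<forall>\<epsilon>. 0 \<le> \<rho> \<epsilon>) \<and> \<rho> 0 = 0 \<and> convex_on UNIV \<rho> \<and>
     (\<forall>\<epsilon> \<epsilon>'. norm \<epsilon> = norm \<epsilon>' \<longrightarrow> \<rho> \<epsilon> = \<rho> \<epsilon>')"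

text \<open>
  The first condition on \<open>\<Theta>\<close> is implied by the one demanding \<open>\<theta> \<in> \<Theta> \<longleftrightarrow> T i \<theta> \<in> \<Theta>\<close> separately
  for each \<open>i < m\<close> (if \<open>m > 0\<close>).
\<close>

definition unitary_system ::
  "(real^'d) set \<Rightarrow> nat \<Rightarrow> (nat \<Rightarrow> real^'d \<Rightarrow> real^'d) \<Rightarrow> bool" where
  "unitary_system \<Theta> m T \<longleftrightarrow>
     (\<exists>A :: nat \<Rightarrow> real^'d^'d.
        (\<forall>i<m. orthogonal_matrix (A i) \<and> T i = (\<lambda>\<theta>. A i *v \<theta>)) \<and>
        (\<forall>\<theta>. \<theta> \<in> \<Theta> \<longleftrightarrow> (\<forall>i<m. T i \<theta> \<in> \<Theta>)) \<and>
        (\<Sum>i<m. A i) = 0)"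

text \<open>
  For possibly non-linear transformations, the norms to be preserved are those of the error
  vectors, i.e. of differences of parameters. Requiring only \<open>norm (T i \<theta>) = norm \<theta>\<close> is not enough:
  take \<open>\<Theta> = {-2, -1, 1, 2}\<close>, \<open>T 0\<close> fixing \<open>1\<close> and \<open>-1\<close> and exchanging \<open>2\<close> and \<open>-2\<close>,
  \<open>T 1 \<theta> = - T 0 \<theta>\<close>, \<open>\<rho> \<epsilon> = \<bar>\<epsilon>\<bar>\<close>, and densities that depend on the sign of \<open>\<theta>\<close> only and have
  disjoint supports for the two signs. With the parameters \<open>1, 2\<close> and equal weights the lower
  bound is \<open>3/2\<close>, but estimating \<open>1\<close> or \<open>-1\<close> according to the observed sign has risk at most \<open>1\<close>.
\<close>

definition norm_preserving_system ::
  "('p::real_normed_vector) set \<Rightarrow> nat \<Rightarrow> (nat \<Rightarrow> 'p \<Rightarrow> 'p) \<Rightarrow> bool" where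
  "norm_preserving_system \<Theta> m T \<longleftrightarrow>
     (\<forall>i<m. T i ` \<Theta> = \<Theta>) \<and>
     (\<forall>i<m. \<forall>\<theta>\<in>\<Theta>. \<forall>\<theta>'\<in>\<Theta>. norm (T i \<theta> - T i \<theta>') = norm (\<theta> - \<theta>')) \<and>
     (\<forall>\<theta>\<in>\<Theta>. (\<Sum>i<m. T i \<theta>) = 0)"

end

(*
  The minimax risk dominates the Bayes risk with prior q on theta_0, ..., theta_(m-1).
  Bounding every q_i * p(x | theta_i) by the smallest one leaves the sum over i of
  rho (g(x) - theta_i).  Each T_i preserves the norms of errors, so this is the sum of
  rho (T_i g(x) - T_i theta_i), and in Jensen's inequality with equal weights the unknown g(x)
  cancels because the T_i sum to zero.
*)

theory Submission
  imports Defs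
begin

text \<open>The right-hand side depends on \<open>y\<close>, the left-hand side does not. With
  \<open>y\<close> the value of an estimator at one observation, this gives a bound free of the
  estimator.\<close>

lemma sum_isometric_loss_ge:
  fixes \<rho> :: "'p::real_normed_vector \<Rightarrow> real"
  assumes \<rho>: "radial_convex_loss \<rho>" and m: "m > 0"
    and iso: "\<And>i. i < m \<Longrightarrow> norm (T i y - T i (\<theta> i)) = norm (y - \<theta> i)"
    and zero: "(\<Sum>i<m. T i y) = 0"
  shows "real m * \<rho> ((1 / real m) *\<^sub>R (\<Sum>i<m. T i (\<theta> i))) \<le> (\<Sum>i<m. \<rho> (y - \<theta> i))"
proof -
  have convex: "convex_on UNIV \<rho>" and radial: "\<And>u v. norm u = norm v \<Longrightarrow> \<rho> u = \<rho> v"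
    using \<rho> unfolding radial_convex_loss_def by blast+
  \<comment> \<open>As the \<open>T i y\<close> sum to zero, the averaged error is the negative of
    the vector on the left; a radial loss does not see the sign.\<close>
  have "\<rho> ((1 / real m) *\<^sub>R (\<Sum>i<m. T i (\<theta> i)))
      = \<rho> (\<Sum>i<m. (1 / real m) *\<^sub>R (T i y - T i (\<theta> i)))"
    by (rule radial) (simp only: scaleR_sum_right[symmetric] sum_subtractf zero diff_0
        scaleR_minus_right norm_minus_cancel)
  also have "\<dots> \<le> (\<Sum>i<m. (1 / real m) * \<rho> (T i y - T i (\<theta> i)))"
    using m by (intro convex_on_sum[OF _ _ convex]) auto
  also have "\<dots> = (\<Sum>i<m. (1 / real m) * \<rho> (y - \<theta> i))"
    by (intro sum.cong refl arg_cong2[where f = "(*)"] radial iso) simp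
  also have "\<dots> = (1 / real m) * (\<Sum>i<m. \<rho> (y - \<theta> i))"
    by (rule sum_distrib_left[symmetric])
  finally show ?thesis
    using m by (simp add: field_simps)
qed

text \<open>A finite convex function on a finite-dimensional space is continuous, hence Borel; this
  is where the type must be Euclidean.\<close>

lemma borel_measurable_radial_convex_loss:
  fixes \<rho> :: "'p::euclidean_space \<Rightarrow> real"
  assumes "radial_convex_loss \<rho>"
  shows "\<rho> \<in> borel_measurable borel"
proof -
  have "convex_on UNIV \<rho>"
    using assms unfolding radial_convex_loss_def by blast
  then have "continuous_on UNIV \<rho>"
    by (rule convex_on_continuous[OF open_UNIV])
  then show ?thesis
    by (rule borel_measurable_continuous_onI)
qed

text \<open>With \<open>R\<close> the risk function of an estimator, this compares its Bayes risk
  under the prior \<open>q\<close> with its worst-case risk, infinite values included.\<close>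

lemma convex_combination_le_SUP_ennreal:
  fixes R :: "'p \<Rightarrow> ennreal"
  assumes "\<And>i. i \<in> I \<Longrightarrow> \<theta> i \<in> \<Theta>" "\<And>i. i \<in> I \<Longrightarrow> 0 \<le> q i" "(\<Sum>i\<in>I. q i) = 1"
  shows "(\<Sum>i\<in>I. ennreal (q i) * R (\<theta> i)) \<le> (SUP t\<in>\<Theta>. R t)"
proof -
  have "(\<Sum>i\<in>I. ennreal (q i) * R (\<theta> i)) \<le> (\<Sum>i\<in>I. ennreal (q i) * (SUP t\<in>\<Theta>. R t))"
    using assms(1) by (intro sum_mono mult_left_mono SUP_upper) auto
  also have "\<dots> = (SUP t\<in>\<Theta>. R t)"
    using assms(2,3) by (simp add: sum_distrib_right[symmetric])
  finally show ?thesis .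
qed

text \<open>The two properties of \<open>T\<close> assumed here are common to the linear and the
  non-linear systems, so a single argument serves both.\<close>

lemma minimax_risk_ge:
  fixes \<rho> :: "'p::euclidean_space \<Rightarrow> real"
  assumes dens: "density_family M \<Theta> p" and \<rho>: "radial_convex_loss \<rho>"
    and \<theta>: "\<And>i. i < m \<Longrightarrow> \<theta> i \<in> \<Theta>"
    and q0: "\<And>i. i < m \<Longrightarrow> 0 \<le> q i" and q1: "(\<Sum>i<m. q i) = 1"
    and iso: "\<And>i u v. i < m \<Longrightarrow> u \<in> \<Theta> \<Longrightarrow> v \<in> \<Theta> \<Longrightarrow> norm (T i u - T i v) = norm (u - v)"
    and zero: "\<And>u. u \<in> \<Theta> \<Longrightarrow> (\<Sum>i<m. T i u) = 0"
  shows "ennreal (real m * \<rho> ((1 / real m) *\<^sub>R (\<Sum>i<m. T i (\<theta> i)))) *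
           (\<integral>\<^sup>+x. ennreal (Min ((\<lambda>i. q i * p (\<theta> i) x) ` {..<m})) \<partial>M)
         \<le> minimax_risk M p \<rho> \<Theta>"
  unfolding minimax_risk_def
proof (rule INF_greatest)
  fix g assume "g \<in> estimators M \<Theta>"
  then have g_meas[measurable]: "g \<in> borel_measurable M" and g_in: "\<And>x. x \<in> space M \<Longrightarrow> g x \<in> \<Theta>"
    by (auto simp: estimators_def measurable_restrict_space2_iff)
  have [measurable]: "\<rho> \<in> borel_measurable borel"
    using \<rho> by (rule borel_measurable_radial_convex_loss)
  have p_meas[measurable]: "p (\<theta> i) \<in> borel_measurable M" if "i < m" for i
    using dens \<theta>[OF that] by (simp add: density_family_def)
  have p0: "0 \<le> p (\<theta> i) x" if "i < m" "x \<in> space M" for i x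
    using dens \<theta>[OF that(1)] that(2) by (simp add: density_family_def)
  have \<rho>0: "0 \<le> \<rho> u" for u
    using \<rho> unfolding radial_convex_loss_def by blast
  \<comment> \<open>An empty sum of weights would be 0 instead of 1. Hence the minimum is over a
    nonempty set, and the Jensen weights \<open>1 / real m\<close> are genuine.\<close>
  have m: "m > 0"
    using q1 by (cases m) auto
  let ?c = "real m * \<rho> ((1 / real m) *\<^sub>R (\<Sum>i<m. T i (\<theta> i)))"
  let ?\<mu> = "\<lambda>x. Min ((\<lambda>i. q i * p (\<theta> i) x) ` {..<m})"
  have c0: "0 \<le> ?c"
    by (simp add: \<rho>0)
  have \<mu>_meas[measurable]: "?\<mu> \<in> borel_measurable M"
    by (rule borel_measurable_Min) auto
  have pointwise: "?c * ?\<mu> x \<le> (\<Sum>i<m. q i * p (\<theta> i) x * \<rho> (g x - \<theta> i))" if x: "x \<in> space M" for x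
  proof -
    have "0 \<le> ?\<mu> x"
      using m q0 p0[OF _ x] by (subst Min_ge_iff) auto
    \<comment> \<open>The Jensen bound is used at \<open>y = g x\<close>, which lies in \<Theta>,
      where the assumptions on \<open>T\<close> hold; the factor \<open>?\<mu> x\<close> is
      nonnegative and so keeps the inequality.\<close>
    then have "?c * ?\<mu> x \<le> (\<Sum>i<m. \<rho> (g x - \<theta> i)) * ?\<mu> x"
      by (intro mult_right_mono sum_isometric_loss_ge \<rho> m iso zero \<theta> g_in x)
    also have "\<dots> = (\<Sum>i<m. ?\<mu> x * \<rho> (g x - \<theta> i))"
      by (simp add: sum_distrib_right mult.commute)
    also have "\<dots> \<le> (\<Sum>i<m. q i * p (\<theta> i) x * \<rho> (g x - \<theta> i))"
      by (intro sum_mono mult_right_mono \<rho>0 Min_le) auto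
    finally show ?thesis .
  qed
  have "ennreal ?c * (\<integral>\<^sup>+x. ennreal (?\<mu> x) \<partial>M) = (\<integral>\<^sup>+x. ennreal (?c * ?\<mu> x) \<partial>M)"
    using c0 by (simp add: ennreal_mult' nn_integral_cmult)
  also have "\<dots> \<le> (\<integral>\<^sup>+x. (\<Sum>i<m. ennreal (q i) * (ennreal (p (\<theta> i) x) * ennreal (\<rho> (g x - \<theta> i)))) \<partial>M)"
  proof (rule nn_integral_mono)
    fix x assume x: "x \<in> space M"
    have "ennreal (?c * ?\<mu> x) \<le> ennreal (\<Sum>i<m. q i * p (\<theta> i) x * \<rho> (g x - \<theta> i))"
      by (rule ennreal_leI) (rule pointwise[OF x])
    \<comment> \<open>Since \<open>ennreal\<close> truncates negative reals to 0, it is moved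
      through the sum and the products by nonnegativity of weights, densities and loss.\<close>
    also have "\<dots> = (\<Sum>i<m. ennreal (q i * p (\<theta> i) x * \<rho> (g x - \<theta> i)))"
      using q0 p0[OF _ x] \<rho>0 by (intro sum_ennreal[symmetric]) auto
    also have "\<dots> = (\<Sum>i<m. ennreal (q i) * (ennreal (p (\<theta> i) x) * ennreal (\<rho> (g x - \<theta> i))))"
      using q0 p0[OF _ x] \<rho>0 by (intro sum.cong refl) (simp add: ennreal_mult mult.assoc)
    finally show "ennreal (?c * ?\<mu> x)
        \<le> (\<Sum>i<m. ennreal (q i) * (ennreal (p (\<theta> i) x) * ennreal (\<rho> (g x - \<theta> i))))" .
  qed
  \<comment> \<open>Integrating the loss against \<open>p (\<theta> i)\<close> is integrating it
    under the measure with that density, so the Bayes risk appears.\<close>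
  also have "\<dots> = (\<Sum>i<m. ennreal (q i) * risk M p \<rho> g (\<theta> i))"
    by (subst nn_integral_sum) (auto simp: nn_integral_cmult nn_integral_density risk_def)
  also have "\<dots> \<le> (SUP t\<in>\<Theta>. risk M p \<rho> g t)"
    using \<theta> q0 q1 by (intro convex_combination_le_SUP_ennreal) auto
  finally show "ennreal ?c * (\<integral>\<^sup>+x. ennreal (?\<mu> x) \<partial>M) \<le> (SUP t\<in>\<Theta>. risk M p \<rho> g t)" .
qed

text \<open>By linearity the difference of two images is the image of the difference, so preserving
  norms of vectors already means preserving distances.\<close>

lemma unitary_system_norm_diff:
  assumes "unitary_system \<Theta> m T" "i < m"
  shows "norm (T i u - T i v) = norm (u - v)"
proof -
  obtain A where A: "orthogonal_matrix A" "T i = (*v) A"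
    using assms by (auto simp: unitary_system_def)
  have "orthogonal_transformation ((*v) A)"
    using A(1) by (simp add: orthogonal_transformation_matrix)
  then show ?thesis
    by (simp add: A(2) matrix_vector_mult_diff_distrib[symmetric] orthogonal_transformation_norm)
qed

lemma unitary_system_sum:
  assumes "unitary_system \<Theta> m T"
  shows "(\<Sum>i<m. T i u) = 0"
proof -
  obtain A where A: "\<And>i. i < m \<Longrightarrow> T i = (*v) (A i)" "(\<Sum>i<m. A i) = 0"
    using assms by (auto simp: unitary_system_def)
  have "(\<Sum>i<m. T i u) = (\<Sum>i<m. A i *v u)"
    by (simp add: A(1))
  also have "\<dots> = (\<Sum>i<m. A i) *v u"
    by (induction m) (simp_all add: matrix_vector_mult_add_rdistrib)
  finally show ?thesis
    by (simp add: A(2))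
qed

theorem theorem2:
  fixes \<nu> :: "'a measure"
    and n m :: nat
    and \<Theta> :: "(real^'d) set"
    and p :: "real^'d \<Rightarrow> (nat \<Rightarrow> 'a) \<Rightarrow> real"
    and \<rho> :: "real^'d \<Rightarrow> real"
    and \<theta> :: "nat \<Rightarrow> real^'d"
    and q :: "nat \<Rightarrow> real"
    and T :: "nat \<Rightarrow> real^'d \<Rightarrow> real^'d"
  assumes "sigma_finite_measure \<nu>"
    and "density_family (obs_space \<nu> n) \<Theta> p"
    and "radial_convex_loss \<rho>"
    and "\<And>i. i < m \<Longrightarrow> \<theta> i \<in> \<Theta>"
    and "\<And>i. i < m \<Longrightarrow> 0 \<le> q i"
    and "(\<Sum>i<m. q i) = 1"
    and "unitary_system \<Theta> m T \<or> norm_preserving_system \<Theta> m T"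
  shows "minimax_risk (obs_space \<nu> n) p \<rho> \<Theta> \<ge>
           ennreal (real m * \<rho> ((1 / real m) *\<^sub>R (\<Sum>i<m. T i (\<theta> i)))) *
           (\<integral>\<^sup>+x. ennreal (Min ((\<lambda>i. q i * p (\<theta> i) x) ` {..<m})) \<partial>(obs_space \<nu> n))"
proof (rule minimax_risk_ge[OF assms(2-6)])
  show "norm (T i u - T i v) = norm (u - v)" if "i < m" "u \<in> \<Theta>" "v \<in> \<Theta>" for i u v
    using assms(7) that by (auto simp: norm_preserving_system_def intro: unitary_system_norm_diff)
  show "(\<Sum>i<m. T i u) = 0" if "u \<in> \<Theta>" for u
    using assms(7) that by (auto simp: norm_preserving_system_def intro: unitary_system_sum)
qed

end
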